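(* Consider a linear, well-posed evolution problem $\partial_tu=\mathcal{L}u$ on $\Omega$, measured in a fixed norm $\|\cdot\|$. (For a second-order-in-time problem, rewrite the equation as a first-order system with state $U=(u,u_t)$.) Advance the solution over $[0,T]$ in $L=T/\Delta t$ uniform blocks of size $\Delta t$, where $L$ is a (positive) integer, using $N_t$ Legendre coefficients in time on each block. Let $e_0$ be the error in the initial state. Assume the following: 1. The exact solution is analytic in time in a complex neighbourhood of $[0,T]$ whose boundary is at least a distance $d>0$ from the real time interval. 2. Peel and pass is exact: the initial data supplied to each block after the first is exactly the numerical final slice of the previous block, so the block interface contributes no additional error. 3. With exact initial data, the per-block final-slice discretisation error is at most $C\varrho_{\Delta t}^{-N_t}+\varepsilon_x$, where $\varepsilon_x$ bounds the spatial truncation error on one block. 4. In the chosen norm, the per-block space-time solve has a uniform per-block stability factor $K\ge0$. Then the error of the final passed slice obeys $$\|u_h(T,\cdot)-u(T,\cdot)\|\le K^L\|e_0\|+\frac{K^L-1}{K-1}\Bigl(C\varrho_{\Delta t}^{-N_t}+\varepsilon_x\Bigr),$$ where the fraction is read as $L$ when $K=1$. The constant $C$ depends on bounds for the analytic continuation of the exact solution in the chosen complex neighbourhood, but is independent of $N_t$, $\Delta t$ and $L$. The parameter $\varrho_{\Delta t}$ may be chosen to satisfy $$1<\varrho_{\Delta t}<\delta+\sqrt{1+\delta^2},\qquad\delta=\frac{2d}{\Delta t},$$ and is then an admissible Bernstein-ellipse parameter for a function analytic at reference-coordinate distance at least $\delta$ from $[-1,1]$. More generally, one may use any admissible Bernstein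 parameter for the solution restricted to a single block.
   Context: The blocks are $[t_{n-1},t_n]$ with $t_n=n\Delta t$, $n=1,\dots,L$. On each block a space-time spectral solver takes an initial slice (at $t_{n-1}$) and returns a numerical solution expanded in Legendre polynomials in time (affinely mapped from the block to $[-1,1]$) and a spatial basis. Its final slice at $t_n$, obtained exactly by evaluating the block expansion at $t_n$ (equivalently, summing the coefficients over the time index), is the passed slice used as the initial data of block $n+1$; $u_h(T,\cdot)$ is the final slice of block $L$ and $u$ is the exact solution. Per-block stability factor: a blocked solve has per-block stability factor $K\ge0$ in a fixed norm if, on every block, the part of the outgoing final-slice error caused by the incoming initial-slice error is bounded by $K$ times that incoming error; equivalently, for the linear homogeneous block error-propagation maps $E_n$ from the incoming state error to the outgoing passed-slice error, $\|E_n\eta\|\le K\|\eta\|$ for every block $n$ and every admissible incoming state error $\eta$. Reference coordinate: the coordinate obtained by mapping the block $[t_{n-1},t_n]$ affinely onto $[-1,1]$. For $\varrho>1$ the Bernstein ellipse $E_\varrho$ is the open region bounded by the ellipse with foci $\pm1$ and semi-axes $\frac12(\varrho+\varrho^{-1})$ and $\frac12(\varrho-\varrho^{-1})$; $\varrho$ is an admissible Bernstein parameter for a function if, in the reference coordinate, the function is analytic on $E_\varrho$. A function is "analytic at reference-coordinate distance at least $\delta$ from $[-1,1]$" if it is analytic in a neighbourhood of $[-1,1]$ whose boundary is at distance at least $\delta$ from $[-1,1]$. *)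

theory Defs
  imports "HOL-Analysis.Analysis"
begin

section \<open>The evolution problem\<close>

text \<open>
  A state (a function on the spatial domain, or a tuple of such functions) is an element of a
  normed space \<open>'a\<close> whose norm is the fixed norm of the error analysis. For a problem of second
  order in time the states are pairs \<open>(u, u\<^sub>t)\<close>. Spatial operators are usually unbounded, so the
  generator \<open>A\<close> comes with a domain \<open>Dom\<close>, which also encodes the boundary conditions.
\<close>

definition linear_operator_on :: "'a::real_vector set \<Rightarrow> ('a \<Rightarrow> 'a) \<Rightarrow> bool" where
  "linear_operator_on Dom A \<longleftrightarrow> subspace Dom \<and>
     (\<forall>x\<in>Dom. \<forall>y\<in>Dom. A (x + y) = A x + A y) \<and> (\<forall>c. \<forall>x\<in>Dom. A (c *\<^sub>R x) = c *\<^sub>R A x)"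

definition evolution_solution ::
    "'a::real_normed_vector set \<Rightarrow> ('a \<Rightarrow> 'a) \<Rightarrow> real \<Rightarrow> (real \<Rightarrow> 'a) \<Rightarrow> bool" where
  "evolution_solution Dom A T u \<longleftrightarrow>
     (\<forall>t\<in>{0..T}. u t \<in> Dom \<and> (u has_vector_derivative A (u t)) (at t within {0..T}))"

text \<open>Well-posedness in the sense of Hadamard: existence, uniqueness, continuous dependence.\<close>

definition well_posed ::
    "'a::real_normed_vector set \<Rightarrow> ('a \<Rightarrow> 'a) \<Rightarrow> real \<Rightarrow> bool" where
  "well_posed Dom A T \<longleftrightarrow>
     (\<forall>v\<in>Dom. \<exists>u. evolution_solution Dom A T u \<and> u 0 = v) \<and>
     (\<forall>u v. evolution_solution Dom A T u \<and> evolution_solution Dom A T v \<and> u 0 = v 0 \<longrightarrow>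
        (\<forall>t\<in>{0..T}. u t = v t)) \<and>
     (\<exists>\<kappa>. \<forall>u v. evolution_solution Dom A T u \<and> evolution_solution Dom A T v \<longrightarrow>
        (\<forall>t\<in>{0..T}. norm (u t - v t) \<le> \<kappa> * norm (u 0 - v 0)))"

section \<open>Analyticity in time\<close>

text \<open>
  The values of an analytic continuation lie in the complexification of the state space. It is
  represented by \<open>'a \<times> 'a\<close>, where \<open>(x, y)\<close> stands for \<open>x + \<i> y\<close> and \<open>(x, 0)\<close> for the state \<open>x\<close>.
  A complex state space is covered as well: an \<open>'a\<close>-valued continuation \<open>G\<close> to a domain symmetric
  about the real axis, such as a tube around an interval or a Bernstein ellipse, corresponds to the
  continuation \<open>((G z + G (cnj z)) / 2, (G z - G (cnj z)) / (2 \<i>))\<close> with values in \<open>'a \<times> 'a\<close>.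
\<close>

definition cscale :: "complex \<Rightarrow> 'a::real_vector \<times> 'a \<Rightarrow> 'a \<times> 'a" where
  "cscale z p = (Re z *\<^sub>R fst p - Im z *\<^sub>R snd p, Re z *\<^sub>R snd p + Im z *\<^sub>R fst p)"

definition vec_analytic_on ::
    "(complex \<Rightarrow> 'a::real_normed_vector \<times> 'a) \<Rightarrow> complex set \<Rightarrow> bool" where
  "vec_analytic_on F D \<longleftrightarrow>
     (\<forall>z\<^sub>0\<in>D. \<exists>r>0. \<exists>c. \<forall>z\<in>ball z\<^sub>0 r. (\<lambda>k. cscale ((z - z\<^sub>0) ^ k) (c k)) sums F z)"

definition complex_nbhd :: "real \<Rightarrow> real \<Rightarrow> complex set \<Rightarrow> bool" where
  "complex_nbhd a b D \<longleftrightarrow> open D \<and> complex_of_real ` {a..b} \<subseteq> D"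

definition analytic_continuation ::
    "(real \<Rightarrow> 'a::real_normed_vector) \<Rightarrow> real \<Rightarrow> real \<Rightarrow> complex set \<Rightarrow> (complex \<Rightarrow> 'a \<times> 'a) \<Rightarrow> bool"
  where
  "analytic_continuation v a b D F \<longleftrightarrow> complex_nbhd a b D \<and> vec_analytic_on F D \<and>
     (\<forall>t\<in>{a..b}. F (complex_of_real t) = (v t, 0))"

text \<open>
  Stated pointwise, since \<^const>\<open>setdist\<close> is 0 for an empty set and the boundary of the whole plane
  is empty.
\<close>

definition boundary_at_distance :: "real \<Rightarrow> real \<Rightarrow> complex set \<Rightarrow> real \<Rightarrow> bool" where
  "boundary_at_distance a b D d \<longleftrightarrow>
     (\<forall>z\<in>frontier D. \<forall>t\<in>{a..b}. d \<le> dist z (complex_of_real t))"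

definition bernstein_ellipse :: "real \<Rightarrow> complex set" where
  "bernstein_ellipse \<rho> =
     {z. (Re z / ((\<rho> + inverse \<rho>) / 2))\<^sup>2 + (Im z / ((\<rho> - inverse \<rho>) / 2))\<^sup>2 < 1}"

text \<open>In the next two definitions \<open>v\<close> is a function of the reference coordinate.\<close>

definition admissible_bernstein :: "real \<Rightarrow> (real \<Rightarrow> 'a::real_normed_vector) \<Rightarrow> bool" where
  "admissible_bernstein \<rho> v \<longleftrightarrow>
     \<rho> > 1 \<and> (\<exists>F. analytic_continuation v (- 1) 1 (bernstein_ellipse \<rho>) F)"

definition analytic_at_distance :: "real \<Rightarrow> (real \<Rightarrow> 'a::real_normed_vector) \<Rightarrow> bool" where
  "analytic_at_distance \<delta> v \<longleftrightarrow>
     (\<exists>D F. analytic_continuation v (- 1) 1 D F \<and> boundary_at_distance (- 1) 1 D \<delta>)"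

section \<open>The blocked space-time solver\<close>

fun legendre :: "nat \<Rightarrow> real \<Rightarrow> real" where
  "legendre 0 x = 1"
| "legendre (Suc 0) x = x"
| "legendre (Suc (Suc n)) x =
     ((2 * real n + 3) * x * legendre (Suc n) x - (real n + 1) * legendre n x) / (real n + 2)"

definition block_time :: "real \<Rightarrow> nat \<Rightarrow> nat \<Rightarrow> real" where
  "block_time T L n = real n * (T / real L)"

definition to_reference :: "real \<Rightarrow> real \<Rightarrow> real \<Rightarrow> real" where
  "to_reference a b t = (2 * t - a - b) / (b - a)"

definition from_reference :: "real \<Rightarrow> real \<Rightarrow> real \<Rightarrow> real" where
  "from_reference a b s = (a + b) / 2 + (b - a) / 2 * s"

definition block_restriction :: "real \<Rightarrow> nat \<Rightarrow> nat \<Rightarrow> (real \<Rightarrow> 'a) \<Rightarrow> real \<Rightarrow> 'a" where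
  "block_restriction T L n u s =
     u (from_reference (block_time T L (n - 1)) (block_time T L n) s)"

text \<open>
  \<open>c k b\<close> is the coefficient of the \<open>k\<close>-th Legendre polynomial in time and of the element \<open>b\<close> of the
  spatial basis \<open>\<Phi>\<close>.
\<close>

definition block_expansion ::
    "'a::real_vector set \<Rightarrow> nat \<Rightarrow> real \<Rightarrow> real \<Rightarrow> (nat \<Rightarrow> 'a \<Rightarrow> real) \<Rightarrow> real \<Rightarrow> 'a" where
  "block_expansion \<Phi> N a b c t =
     (\<Sum>k<N. \<Sum>\<phi>\<in>\<Phi>. (c k \<phi> * legendre k (to_reference a b t)) *\<^sub>R \<phi>)"

definition final_slice ::
    "'a::real_vector set \<Rightarrow> nat \<Rightarrow> real \<Rightarrow> nat \<Rightarrow> nat \<Rightarrow> (nat \<Rightarrow> 'a \<Rightarrow> real) \<Rightarrow> 'a" where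
  "final_slice \<Phi> N T L n c =
     block_expansion \<Phi> N (block_time T L (n - 1)) (block_time T L n) c (block_time T L n)"

text \<open>
  A solver \<open>S\<close> maps the block number and the initial slice to the coefficients of the numerical
  solution on that block; \<open>w n\<close> is the initial slice supplied to block \<open>n\<close>. The first slice \<open>w 1\<close> is
  the approximation of the initial state.
\<close>

definition peel_and_pass ::
    "'a::real_vector set \<Rightarrow> nat \<Rightarrow> real \<Rightarrow> nat \<Rightarrow> (nat \<Rightarrow> 'a \<Rightarrow> nat \<Rightarrow> 'a \<Rightarrow> real) \<Rightarrow>
     (nat \<Rightarrow> 'a) \<Rightarrow> bool" where
  "peel_and_pass \<Phi> N T L S w \<longleftrightarrow>
     (\<forall>n\<in>{1..<L}. w (Suc n) = final_slice \<Phi> N T L n (S n (w n)))"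

text \<open>
  \<open>E\<close> is the error-propagation map of block \<open>n\<close>: if the exact incoming state is \<open>v\<close> and the supplied
  one is \<open>v + \<eta>\<close>, then \<open>E \<eta>\<close> is the part of the outgoing error that is caused by \<open>\<eta>\<close>. The set \<open>X\<close> is
  the space of admissible states and state errors. Linearity of \<open>E\<close> on the whole type is no
  restriction, as linear maps extend from subspaces.
\<close>

definition block_stability_factor ::
    "'a::real_normed_vector set \<Rightarrow> 'a set \<Rightarrow> nat \<Rightarrow> real \<Rightarrow> nat \<Rightarrow>
     (nat \<Rightarrow> 'a \<Rightarrow> nat \<Rightarrow> 'a \<Rightarrow> real) \<Rightarrow> real \<Rightarrow> bool" where
  "block_stability_factor X \<Phi> N T L S K \<longleftrightarrow> K \<ge> 0 \<and>
     (\<forall>n\<in>{1..L}. \<exists>E. linear E \<and>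
        (\<forall>v\<in>X. \<forall>\<eta>\<in>X. final_slice \<Phi> N T L n (S n (v + \<eta>)) =
           final_slice \<Phi> N T L n (S n v) + E \<eta>) \<and>
        (\<forall>\<eta>\<in>X. norm (E \<eta>) \<le> K * norm \<eta>))"

lemma legendre_1: "legendre n 1 = 1"
  by (induction n "1::real" rule: legendre.induct) (auto simp: field_simps)

lemma bernstein_ellipse_real_segment:
  assumes "\<rho> > 1" "s \<in> {- 1..1}"
  shows "complex_of_real s \<in> bernstein_ellipse \<rho>"
proof -
  have "(\<rho> - 1)\<^sup>2 > 0"
    using assms(1) by simp
  then have "(\<rho> + inverse \<rho>) / 2 > 1"
    using assms(1) by (simp add: field_simps power2_eq_square)
  then have "\<bar>s / ((\<rho> + inverse \<rho>) / 2)\<bar> < 1"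
    using assms(2) by (auto simp: abs_divide divide_less_eq abs_le_iff)
  then show ?thesis
    by (simp add: bernstein_ellipse_def abs_square_less_1)
qed

lemma final_slice_eq_sum_coefficients:
  assumes "T > 0" "1 \<le> n" "n \<le> L"
  shows "final_slice \<Phi> N T L n c = (\<Sum>k<N. \<Sum>\<phi>\<in>\<Phi>. c k \<phi> *\<^sub>R \<phi>)"
proof -
  have "block_time T L (n - 1) < block_time T L n"
    using assms by (auto simp: block_time_def divide_simps)
  then have "to_reference (block_time T L (n - 1)) (block_time T L n) (block_time T L n) = 1"
    by (simp add: to_reference_def)
  then show ?thesis
    by (simp add: final_slice_def block_expansion_def legendre_1)
qed

end

theory Submission
  imports Defs
begin

text \<open>
  The incoming error of a block is amplified by at most \<open>K\<close> and the block adds at most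
  \<open>C \<rho>\<^sup>-\<^sup>N + \<epsilon>\<close>, so the error bound is a discrete Gronwall estimate. For the
  Bernstein parameter, \<open>r < \<delta> + sqrt (1 + \<delta>\<^sup>2)\<close> says exactly that the semi-minor axis
  of the ellipse is less than \<open>\<delta>\<close>, and every point of the ellipse is closer to the segment \<open>[-1, 1]\<close>
  than the length of the semi-minor axis; hence the ellipse lies in the domain of analyticity.
\<close>

section \<open>Error accumulation over the blocks\<close>

text \<open>Unrolling the recursion multiplies the bound so far by \<open>K\<close> and adds a fresh
  \<open>B\<close>, which extends the geometric sum by one term. The sum is not put in closed form,
  so that \<open>K = 1\<close> needs no separate case.\<close>

lemma affine_recursion_bound:
  fixes e :: "nat \<Rightarrow> real"
  assumes "K \<ge> 0" and step: "\<And>n. n < L \<Longrightarrow> e (Suc n) \<le> K * e n + B" and "n \<le> L"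
  shows "e n \<le> K ^ n * e 0 + (\<Sum>i<n. K ^ i) * B"
  using \<open>n \<le> L\<close>
proof (induction n)
  case 0
  then show ?case by simp
next
  case (Suc n)
  have "e (Suc n) \<le> K * e n + B"
    using Suc.prems step by simp
  also have "\<dots> \<le> K * (K ^ n * e 0 + (\<Sum>i<n. K ^ i) * B) + B"
    using Suc \<open>K \<ge> 0\<close> by (simp add: mult_left_mono)
  also have "\<dots> = K ^ Suc n * e 0 + (\<Sum>i<Suc n. K ^ i) * B"
    \<comment> \<open>Multiplication by \<open>K\<close> shifts all exponents up by one, so the new
      \<open>B\<close> becomes the term with exponent 0; the sum is therefore split at its lower
      end.\<close>
    unfolding sum.lessThan_Suc_shift by (simp add: sum_distrib_left algebra_simps)
  finally show ?case .
qed

lemma final_slice_in_subspace: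
  assumes "subspace X" "\<Phi> \<subseteq> X"
  shows "final_slice \<Phi> N T L n c \<in> X"
  unfolding final_slice_def block_expansion_def
  using assms by (intro subspace_sum subspace_scale) auto

text \<open>The exact state serves as the base point of the stability condition. The outgoing error
  then splits into the propagated incoming error, at most \<open>K\<close> times its norm, and the
  error of the block started from exact data, at most \<open>B\<close>.\<close>

lemma peel_and_pass_error_bound:
  fixes X \<Phi> :: "'a::real_normed_vector set" and K B :: real
  assumes X: "subspace X" "\<Phi> \<subseteq> X"
    and stab: "block_stability_factor X \<Phi> N T L S K"
    and u: "\<And>n. n \<le> L \<Longrightarrow> u (block_time T L n) \<in> X"
    and disc: "\<And>n. n \<in> {1..L} \<Longrightarrow>
      norm (final_slice \<Phi> N T L n (S n (u (block_time T L (n - 1)))) - u (block_time T L n)) \<le> B"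
    and w: "w 1 \<in> X" "peel_and_pass \<Phi> N T L S w"
    and "L \<ge> 1"
  shows "norm (final_slice \<Phi> N T L L (S L (w L)) - u (block_time T L L))
    \<le> K ^ L * norm (w 1 - u (block_time T L 0)) + (\<Sum>i<L. K ^ i) * B"
proof -
  \<comment> \<open>\<open>s n\<close> is the numerical state at the end of block \<open>n\<close>;
    putting the initial slice at index 0 lets the first block follow the same recursion as the
    others.\<close>
  define s where "s n = (if n = 0 then w 1 else final_slice \<Phi> N T L n (S n (w n)))" for n
  define e where "e n = norm (s n - u (block_time T L n))" for n
  have K: "K \<ge> 0"
    using stab by (simp add: block_stability_factor_def)
  have s_X: "s n \<in> X" for n
    using w(1) final_slice_in_subspace[OF X] by (simp add: s_def)
  \<comment> \<open>This is where exact passing enters: for \<open>n = 0\<close> it is the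
    convention above, for \<open>0 < n < L\<close> it is \<open>peel_and_pass\<close>.\<close>
  have w_s: "w (Suc n) = s n" if "n < L" for n
    using w(2) that by (auto simp: peel_and_pass_def s_def)
  have step: "e (Suc n) \<le> K * e n + B" if "n < L" for n
  proof -
    define \<eta> where "\<eta> = s n - u (block_time T L n)"
    \<comment> \<open>The stability bound covers errors in \<open>X\<close> only. All numerical
      slices lie in \<open>X\<close> because the spatial basis does.\<close>
    have "\<eta> \<in> X"
      unfolding \<eta>_def using that by (intro subspace_diff X s_X u) auto
    from that have "Suc n \<in> {1..L}" by simp
    with stab obtain E where
      E: "\<forall>v\<in>X. \<forall>\<eta>\<in>X. final_slice \<Phi> N T L (Suc n) (S (Suc n) (v + \<eta>)) =
            final_slice \<Phi> N T L (Suc n) (S (Suc n) v) + E \<eta>"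
        "\<forall>\<eta>\<in>X. norm (E \<eta>) \<le> K * norm \<eta>"
      unfolding block_stability_factor_def by fast
    let ?f = "final_slice \<Phi> N T L (Suc n) (S (Suc n) (u (block_time T L n)))"
    have "s (Suc n) = final_slice \<Phi> N T L (Suc n) (S (Suc n) (u (block_time T L n) + \<eta>))"
      by (simp add: s_def[of "Suc n"] w_s[OF that] \<eta>_def)
    also have "\<dots> = ?f + E \<eta>"
      using that by (intro E(1)[rule_format] u \<open>\<eta> \<in> X\<close>) simp
    finally have "e (Suc n) = norm (E \<eta> + (?f - u (block_time T L (Suc n))))"
      by (simp add: e_def algebra_simps)
    also have "\<dots> \<le> K * norm \<eta> + B"
      using bspec[OF E(2) \<open>\<eta> \<in> X\<close>] disc[of "Suc n"] that by (intro norm_triangle_mono) auto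
    finally show ?thesis
      by (simp add: e_def \<eta>_def)
  qed
  have "e L \<le> K ^ L * e 0 + (\<Sum>i<L. K ^ i) * B"
    using K step by (rule affine_recursion_bound) auto
  then show ?thesis
    using \<open>L \<ge> 1\<close> by (simp add: e_def s_def)
qed

section \<open>Restriction to a block\<close>

lemma vec_analytic_on_subset:
  "vec_analytic_on F D \<Longrightarrow> E \<subseteq> D \<Longrightarrow> vec_analytic_on F E"
  unfolding vec_analytic_on_def by blast

text \<open>Substituting the affine map into a local power series leaves a power series: the shift
  \<open>p\<close> cancels in differences, and the factor \<open>m ^ k\<close> is absorbed into the
  \<open>k\<close>-th coefficient. The radius is divided by \<open>m\<close>.\<close>

lemma vec_analytic_on_affine:
  fixes p m :: real
  assumes F: "vec_analytic_on F D" and "m > 0"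
  defines "g \<equiv> \<lambda>z. complex_of_real p + complex_of_real m * z"
  shows "vec_analytic_on (\<lambda>z. F (g z)) (g -` D)"
  unfolding vec_analytic_on_def
proof
  fix z\<^sub>0 assume "z\<^sub>0 \<in> g -` D"
  then obtain r c where r: "r > 0"
    and c: "\<And>z. z \<in> ball (g z\<^sub>0) r \<Longrightarrow> (\<lambda>k. cscale ((z - g z\<^sub>0) ^ k) (c k)) sums F z"
    using F unfolding vec_analytic_on_def by force
  have diff: "g z - g z\<^sub>0 = complex_of_real m * (z - z\<^sub>0)" for z
    by (simp add: g_def algebra_simps)
  have "(\<lambda>k. cscale ((z - z\<^sub>0) ^ k) (m ^ k *\<^sub>R c k)) sums F (g z)"
    if "z \<in> ball z\<^sub>0 (r / m)" for z
  proof -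
    have "dist (g z) (g z\<^sub>0) = m * dist z z\<^sub>0"
      using \<open>m > 0\<close> by (simp add: dist_norm diff norm_mult)
    then have "g z \<in> ball (g z\<^sub>0) r"
      using that \<open>m > 0\<close> by (simp add: dist_commute field_simps)
    then have "(\<lambda>k. cscale ((g z - g z\<^sub>0) ^ k) (c k)) sums F (g z)"
      by (rule c)
    \<comment> \<open>Since \<open>m ^ k\<close> is real, it scales both components alike and can be
      moved from the complex factor to the vector.\<close>
    moreover have "cscale ((g z - g z\<^sub>0) ^ k) (c k) = cscale ((z - z\<^sub>0) ^ k) (m ^ k *\<^sub>R c k)" for k
      by (simp add: diff power_mult_distrib cscale_def mult.commute flip: of_real_power)
    ultimately show ?thesis by simp
  qed
  moreover have "r / m > 0"
    using r \<open>m > 0\<close> by simp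
  ultimately show "\<exists>r>0. \<exists>c. \<forall>z\<in>ball z\<^sub>0 r. (\<lambda>k. cscale ((z - z\<^sub>0) ^ k) (c k)) sums F (g z)"
    by (intro exI[of _ "r / m"] exI[of _ "\<lambda>k. m ^ k *\<^sub>R c k"] conjI ballI)
qed

text \<open>The map from the reference coordinate to time stretches distances by
  \<open>(b - a) / 2\<close>. Pulling the domain and the continuation back along its complex
  extension \<open>g\<close> hence divides the distance \<open>d\<close> by this factor.\<close>

lemma analytic_at_distance_from_reference:
  fixes u :: "real \<Rightarrow> 'a::real_normed_vector"
  assumes F: "analytic_continuation u 0 T D F" and d: "boundary_at_distance 0 T D d"
    and ab: "0 \<le> a" "a < b" "b \<le> T"
  shows "analytic_at_distance (2 * d / (b - a)) (\<lambda>s. u (from_reference a b s))"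
proof -
  define p m where "p = (a + b) / 2" and "m = (b - a) / 2"
  have m: "m > 0"
    using ab by (simp add: m_def)
  define g where "g = (\<lambda>z. complex_of_real p + complex_of_real m * z)"
  have cont: "continuous_on A g" for A
    unfolding g_def by (intro continuous_intros)
  have D: "open D" "complex_of_real ` {0..T} \<subseteq> D" "vec_analytic_on F D"
    and Fu: "\<And>t. t \<in> {0..T} \<Longrightarrow> F (complex_of_real t) = (u t, 0)"
    using F by (auto simp: analytic_continuation_def complex_nbhd_def)
  have g_real: "g (complex_of_real s) = complex_of_real (from_reference a b s)" for s
    by (simp add: g_def p_def m_def from_reference_def)
  have range: "from_reference a b s \<in> {0..T}" if "s \<in> {-1..1}" for s
  proof -
    have "m * (-1) \<le> m * s" "m * s \<le> m * 1"
      using that m by (intro mult_left_mono; simp)+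
    then have "a \<le> p + m * s" "p + m * s \<le> b"
      by (simp_all add: p_def m_def field_simps)
    then show ?thesis
      using ab by (simp add: from_reference_def p_def m_def)
  qed
  have "open (g -` D)"
    using D(1) cont by (rule open_vimage)
  have "analytic_continuation (\<lambda>s. u (from_reference a b s)) (-1) 1 (g -` D) (\<lambda>z. F (g z))"
    unfolding analytic_continuation_def complex_nbhd_def
  proof (intro conjI ballI)
    show "vec_analytic_on (\<lambda>z. F (g z)) (g -` D)"
      unfolding g_def by (rule vec_analytic_on_affine[OF D(3) m])
    show "complex_of_real ` {-1..1} \<subseteq> g -` D"
      using D(2) range by (force simp: g_real)
  qed (use \<open>open (g -` D)\<close> range Fu in \<open>simp_all add: g_real\<close>)
  moreover have "boundary_at_distance (-1) 1 (g -` D) (2 * d / (b - a))"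
    unfolding boundary_at_distance_def
  proof (intro ballI)
    fix z s assume z: "z \<in> frontier (g -` D)" and s: "s \<in> {- 1..1::real}"
    \<comment> \<open>A frontier point of the preimage is sent to the frontier of \<open>D\<close>:
      continuity puts its image into the closure of \<open>D\<close>, and openness of the preimage
      keeps it out of \<open>D\<close>.\<close>
    have "z \<in> closure (g -` D)" "z \<notin> g -` D"
      using z \<open>open (g -` D)\<close> by (auto simp: frontier_def interior_open)
    moreover have "g ` closure (g -` D) \<subseteq> closure D"
      using cont closure_subset[of D] by (intro image_closure_subset) auto
    ultimately have "g z \<in> frontier D"
      using D(1) by (auto simp: frontier_def interior_open)
    then have "d \<le> dist (g z) (g (complex_of_real s))"
      using d range[OF s] by (simp add: boundary_at_distance_def g_real)
    also have "\<dots> = norm (complex_of_real m * (z - complex_of_real s))"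
      by (simp add: dist_norm g_def algebra_simps)
    also have "\<dots> = m * dist z (complex_of_real s)"
      using m by (simp add: norm_mult dist_norm)
    finally show "2 * d / (b - a) \<le> dist z (complex_of_real s)"
      using ab by (simp add: m_def field_simps)
  qed
  ultimately show ?thesis
    unfolding analytic_at_distance_def by blast
qed

lemma analytic_at_distance_block_restriction:
  fixes u :: "real \<Rightarrow> 'a::real_normed_vector"
  assumes "analytic_continuation u 0 T D F" "boundary_at_distance 0 T D d"
    and "T > 0" "n \<in> {1..L}"
  shows "analytic_at_distance (2 * d / (T / real L)) (block_restriction T L n u)"
proof -
  let ?a = "block_time T L (n - 1)" and ?b = "block_time T L n"
  \<comment> \<open>The last equation relies on \<open>n \<ge> 1\<close>, as subtraction on naturals
    is truncated.\<close>
  have L: "real L > 0" "real n \<le> real L" "real (n - 1) = real n - 1"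
    using assms(4) by auto
  then have len: "?b - ?a = T / real L"
    by (simp add: block_time_def field_simps)
  moreover have "T / real L > 0"
    using L \<open>T > 0\<close> by simp
  ultimately have "?a < ?b"
    by linarith
  moreover have "0 \<le> ?a"
    using \<open>T > 0\<close> by (simp add: block_time_def)
  moreover have "?b \<le> T"
    using L \<open>T > 0\<close> by (simp add: block_time_def field_simps)
  ultimately show ?thesis
    using analytic_at_distance_from_reference[OF assms(1,2), of ?a ?b]
    unfolding len block_restriction_def[abs_def] by blast
qed

section \<open>The Bernstein ellipse\<close>

text \<open>Writing the divisions as multiplications by constants makes continuity hold without a
  condition that the semi-axes are nonzero.\<close>

lemma open_bernstein_ellipse: "open (bernstein_ellipse \<rho>)"
proof -
  have "open {z. (Re z * c)\<^sup>2 + (Im z * c')\<^sup>2 < 1}" for c c' :: real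
    by (intro open_Collect_less continuous_intros)
  then show ?thesis
    unfolding bernstein_ellipse_def divide_inverse .
qed

lemma bernstein_ellipse_near_segment:
  assumes "\<rho> > 1" "z \<in> bernstein_ellipse \<rho>"
  obtains s where "s \<in> {-1..1}" "dist z (complex_of_real s) < (\<rho> - inverse \<rho>) / 2"
proof -
  define \<alpha> \<beta> where "\<alpha> = (\<rho> + inverse \<rho>) / 2" and "\<beta> = (\<rho> - inverse \<rho>) / 2"
  define x y where "x = Re z" and "y = Im z"
  have "inverse \<rho> < 1" "inverse \<rho> > 0"
    using assms(1) by (simp_all add: inverse_less_1_iff)
  then have pos: "\<alpha> > 0" "\<beta> > 0"
    using assms(1) by (simp_all add: \<alpha>_def \<beta>_def add_pos_pos)
  \<comment> \<open>This relation between the semi-axes expresses that the foci are 1 and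
    -1.\<close>
  have axes: "\<alpha>\<^sup>2 = 1 + \<beta>\<^sup>2"
    using assms(1) by (simp add: \<alpha>_def \<beta>_def field_simps power2_eq_square)
  \<comment> \<open>\<open>q\<close> is the share of the real part in the ellipse inequality; it
    bounds the imaginary part and determines \<open>x\<close> up to sign.\<close>
  define q where "q = (x / \<alpha>)\<^sup>2"
  have q: "q \<ge> 0" "q + (y / \<beta>)\<^sup>2 < 1"
    using assms(2) by (simp_all add: q_def bernstein_ellipse_def \<alpha>_def \<beta>_def x_def y_def)
  then have "(y / \<beta>)\<^sup>2 < 1 - q" by simp
  then have y: "y\<^sup>2 < \<beta>\<^sup>2 * (1 - q)"
    using pos by (simp add: power_divide field_simps)
  have x: "x\<^sup>2 = (1 + \<beta>\<^sup>2) * q"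
    using pos by (simp add: q_def power_divide flip: axes)
  have "q < 1"
    using q(2) zero_le_power2[of "y / \<beta>"] by linarith
  \<comment> \<open>The point of the segment nearest to \<open>z\<close> is the real part clamped to
    the segment.\<close>
  define s where "s = max (-1) (min 1 x)"
  have "(x - s)\<^sup>2 + y\<^sup>2 < \<beta>\<^sup>2"
  proof (cases "\<bar>x\<bar> \<le> 1")
    case True
    then have "s = x" by (simp add: s_def abs_le_iff)
    moreover have "\<beta>\<^sup>2 * (1 - q) \<le> \<beta>\<^sup>2"
      using q(1) by (simp add: mult_left_le)
    ultimately show ?thesis using y by simp
  next
    case False
    then have "(x - s)\<^sup>2 = x\<^sup>2 - 2 * \<bar>x\<bar> + 1"
      by (auto simp: s_def min_def max_def abs_if power2_eq_square algebra_simps)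
    \<comment> \<open>Beyond an endpoint, the terms in \<open>\<beta>\<close> and \<open>q\<close>
      from \<open>x\<close> and \<open>y\<close> add up to less than \<open>\<beta>\<close> squared
      plus \<open>q\<close>. The remainder \<open>q - 2 * \<bar>x\<bar> + 1\<close> is negative
      because \<open>q < 1 < \<bar>x\<bar>\<close>.\<close>
    then have "(x - s)\<^sup>2 + y\<^sup>2 < \<beta>\<^sup>2 + (q - 2 * \<bar>x\<bar> + 1)"
      using y unfolding x by (simp add: algebra_simps)
    then show ?thesis using False \<open>q < 1\<close> by simp
  qed
  moreover have "dist z (complex_of_real s) = sqrt ((x - s)\<^sup>2 + y\<^sup>2)"
    by (simp add: dist_norm cmod_def x_def y_def)
  ultimately have "dist z (complex_of_real s) < \<beta>"
    using pos by (simp add: real_less_lsqrt real_sqrt_less_iff real_sqrt_unique)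
  then show ?thesis
    by (intro that[of s]) (auto simp: s_def \<beta>_def)
qed

text \<open>Otherwise, completing the square makes \<open>r - \<delta>\<close> at least
  \<open>sqrt (1 + \<delta>\<^sup>2)\<close> in absolute value. A nonnegative difference contradicts
  the upper bound on \<open>r\<close>; a negative one would force \<open>r < 0\<close>.\<close>

lemma semi_minor_axis_less:
  assumes "1 < r" "r < \<delta> + sqrt (1 + \<delta>\<^sup>2)"
  shows "(r - inverse r) / 2 < \<delta>"
proof (rule ccontr)
  assume "\<not> ?thesis"
  then have "r\<^sup>2 - 1 \<ge> 2 * \<delta> * r"
    using assms(1) by (simp add: field_simps power2_eq_square)
  then have "sqrt (1 + \<delta>\<^sup>2) \<le> \<bar>r - \<delta>\<bar>"
    by (intro real_le_lsqrt) (simp_all add: power2_eq_square algebra_simps)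
  moreover have "sqrt (1 + \<delta>\<^sup>2) > \<delta>"
    by (rule real_less_rsqrt) simp
  ultimately show False
    using assms by (auto simp: abs_if split: if_splits)
qed

text \<open>The ball is connected, meets \<open>D\<close> in its centre and contains no frontier
  point of \<open>D\<close>, so it cannot leave \<open>D\<close>.\<close>

lemma ball_subset_if_boundary_at_distance:
  assumes D: "complex_nbhd a b D" "boundary_at_distance a b D \<delta>" and s: "s \<in> {a..b}"
  shows "ball (complex_of_real s) \<delta> \<subseteq> D"
proof (cases "\<delta> > 0")
  case True
  have "complex_of_real s \<in> D"
    using D(1) s by (auto simp: complex_nbhd_def)
  moreover have "ball (complex_of_real s) \<delta> \<inter> frontier D = {}"
    using D(2) s by (force simp: boundary_at_distance_def dist_commute)
  moreover have "complex_of_real s \<in> ball (complex_of_real s) \<delta>"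
    using True by simp
  ultimately show ?thesis
    using connected_Int_frontier[of "ball (complex_of_real s) \<delta>" D] connected_ball by blast
next
  case False
  then show ?thesis by (simp add: ball_empty)
qed

lemma admissible_bernstein_if_analytic_at_distance:
  fixes v :: "real \<Rightarrow> 'a::real_normed_vector"
  assumes "analytic_at_distance \<delta> v" "1 < r" "r < \<delta> + sqrt (1 + \<delta>\<^sup>2)"
  shows "admissible_bernstein r v"
proof -
  obtain D F where F: "analytic_continuation v (-1) 1 D F"
    and d: "boundary_at_distance (-1) 1 D \<delta>"
    using assms(1) by (auto simp: analytic_at_distance_def)
  have "bernstein_ellipse r \<subseteq> D"
  proof
    fix z assume "z \<in> bernstein_ellipse r"
    with assms(2) obtain s where s: "s \<in> {-1..1}"
      "dist z (complex_of_real s) < (r - inverse r) / 2"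
      by (rule bernstein_ellipse_near_segment)
    then have "z \<in> ball (complex_of_real s) \<delta>"
      using semi_minor_axis_less[OF assms(2,3)] by (simp add: dist_commute)
    then show "z \<in> D"
      using F d s(1) ball_subset_if_boundary_at_distance
      by (fastforce simp: analytic_continuation_def)
  qed
  then have "analytic_continuation v (-1) 1 (bernstein_ellipse r) F"
    using F assms(2) vec_analytic_on_subset bernstein_ellipse_real_segment
    by (auto simp: analytic_continuation_def complex_nbhd_def open_bernstein_ellipse)
  then show ?thesis
    using assms(2) by (auto simp: admissible_bernstein_def)
qed

section \<open>Error bound and admissible Bernstein parameters\<close>

theorem theorem4p5:
  fixes Dom X \<Phi> :: "'a::real_normed_vector set"
    and A :: "'a \<Rightarrow> 'a"
    and T d :: real
    and \<U> :: "(real \<Rightarrow> 'a) set"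
    and D W :: "complex set"
    and F :: "(real \<Rightarrow> 'a) \<Rightarrow> complex \<Rightarrow> 'a \<times> 'a"
    and M :: "(real \<Rightarrow> 'a) \<Rightarrow> real"
    and C :: "real \<Rightarrow> real"
    and \<rho> :: "real \<Rightarrow> real"
    and S :: "nat \<Rightarrow> nat \<Rightarrow> nat \<Rightarrow> 'a \<Rightarrow> nat \<Rightarrow> 'a \<Rightarrow> real"
    and \<epsilon> K :: "nat \<Rightarrow> nat \<Rightarrow> real"
  assumes time: "T > 0"
    and operator: "linear_operator_on Dom A"
    and well_posed: "well_posed Dom A T"
    and states: "subspace X"
    and basis: "finite \<Phi>" "independent \<Phi>" "\<Phi> \<subseteq> X"
    and exact: "\<And>u. u \<in> \<U> \<Longrightarrow> evolution_solution Dom A T u"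
               "\<And>u t. u \<in> \<U> \<Longrightarrow> t \<in> {0..T} \<Longrightarrow> u t \<in> X"
    and analytic: "d > 0" "boundary_at_distance 0 T D d"
                  "\<And>u. u \<in> \<U> \<Longrightarrow> analytic_continuation u 0 T D (F u)"
    and bounds: "complex_nbhd 0 T W" "W \<subseteq> D"
                "\<And>u z. u \<in> \<U> \<Longrightarrow> z \<in> W \<Longrightarrow> norm (F u z) \<le> M u"
    and parameter:
      "\<And>L. L \<ge> 1 \<Longrightarrow>
         (let \<delta> = 2 * d / (T / real L)
          in 1 < \<rho> (T / real L) \<and> \<rho> (T / real L) < \<delta> + sqrt (1 + \<delta>\<^sup>2)) \<or>
         (\<forall>u\<in>\<U>. \<forall>n\<in>{1..L}. admissible_bernstein (\<rho> (T / real L)) (block_restriction T L n u))"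
    and discretisation:
      "\<And>u N L n. u \<in> \<U> \<Longrightarrow> N \<ge> 1 \<Longrightarrow> L \<ge> 1 \<Longrightarrow> n \<in> {1..L} \<Longrightarrow>
         norm (final_slice \<Phi> N T L n (S N L n (u (block_time T L (n - 1)))) - u (block_time T L n))
           \<le> C (M u) * \<rho> (T / real L) powi (- int N) + \<epsilon> N L"
    and stability:
      "\<And>N L. N \<ge> 1 \<Longrightarrow> L \<ge> 1 \<Longrightarrow> block_stability_factor X \<Phi> N T L (S N L) (K N L)"
  shows "(\<forall>u\<in>\<U>. \<forall>N\<ge>1. \<forall>L\<ge>1. \<forall>w. w 1 \<in> X \<and> peel_and_pass \<Phi> N T L (S N L) w \<longrightarrow>
            norm (final_slice \<Phi> N T L L (S N L L (w L)) - u T)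
              \<le> K N L ^ L * norm (w 1 - u 0) +
                 (if K N L = 1 then real L else (K N L ^ L - 1) / (K N L - 1)) *
                 (C (M u) * \<rho> (T / real L) powi (- int N) + \<epsilon> N L)) \<and>
         (\<forall>L\<ge>1. let \<delta> = 2 * d / (T / real L) in
            {1<..<\<delta> + sqrt (1 + \<delta>\<^sup>2)} \<noteq> {} \<and>
            (\<forall>u\<in>\<U>. \<forall>n\<in>{1..L}. analytic_at_distance \<delta> (block_restriction T L n u)) \<and>
            (\<forall>r\<in>{1<..<\<delta> + sqrt (1 + \<delta>\<^sup>2)}.
               (\<forall>v :: real \<Rightarrow> 'a. analytic_at_distance \<delta> v \<longrightarrow> admissible_bernstein r v) \<and>
               (\<forall>u\<in>\<U>. \<forall>n\<in>{1..L}. admissible_bernstein r (block_restriction T L n u))))"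
proof (intro conjI ballI allI impI, elim conjE)
  fix u N L w
  assume u: "u \<in> \<U>" and N: "1 \<le> N" and L: "1 \<le> (L::nat)"
    and w: "w 1 \<in> X" "peel_and_pass \<Phi> N T L (S N L) w"
  let ?B = "C (M u) * \<rho> (T / real L) powi (- int N) + \<epsilon> N L"
  have T_range: "block_time T L n \<in> {0..T}" if "n \<le> L" for n
    using that L time by (simp add: block_time_def field_simps)
  have "norm (final_slice \<Phi> N T L L (S N L L (w L)) - u (block_time T L L))
    \<le> K N L ^ L * norm (w 1 - u (block_time T L 0)) + (\<Sum>i<L. K N L ^ i) * ?B"
  proof (rule peel_and_pass_error_bound[OF states basis(3) stability[OF N L]])
    show "u (block_time T L n) \<in> X" if "n \<le> L" for n
      using exact(2)[OF u] T_range[OF that] .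
  qed (use discretisation[OF u N L] w L in simp_all)
  \<comment> \<open>Only here is the geometric sum put in closed form; for \<open>K N L = 1\<close>
    its \<open>L\<close> unit terms give the value \<open>L\<close>.\<close>
  moreover have "(\<Sum>i<L. K N L ^ i) =
      (if K N L = 1 then real L else (K N L ^ L - 1) / (K N L - 1))"
    using geometric_sum[of "K N L" L] by simp
  moreover have "block_time T L L = T" "block_time T L 0 = 0"
    using L by (simp_all add: block_time_def)
  ultimately show "norm (final_slice \<Phi> N T L L (S N L L (w L)) - u T)
      \<le> K N L ^ L * norm (w 1 - u 0) +
        (if K N L = 1 then real L else (K N L ^ L - 1) / (K N L - 1)) * ?B"
    by simp
next
  fix L :: nat
  assume L: "1 \<le> L"
  define \<delta> where "\<delta> = 2 * d / (T / real L)"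
  \<comment> \<open>A positive \<open>\<delta>\<close> pushes the upper limit strictly above 1, so
    the open interval of parameters is nonempty.\<close>
  have "\<delta> > 0"
    using analytic(1) time L by (simp add: \<delta>_def)
  moreover have "sqrt (1 + \<delta>\<^sup>2) \<ge> 1"
    by simp
  ultimately have range_nonempty: "1 < \<delta> + sqrt (1 + \<delta>\<^sup>2)"
    by linarith
  have restr: "analytic_at_distance \<delta> (block_restriction T L n u)"
    if "u \<in> \<U>" "n \<in> {1..L}" for u n
    unfolding \<delta>_def
    using analytic(3)[OF that(1)] analytic(2) time that(2)
    by (rule analytic_at_distance_block_restriction)
  show "let \<delta> = 2 * d / (T / real L) in
      {1<..<\<delta> + sqrt (1 + \<delta>\<^sup>2)} \<noteq> {} \<and>
      (\<forall>u\<in>\<U>. \<forall>n\<in>{1..L}. analytic_at_distance \<delta> (block_restriction T L n u)) \<and>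
      (\<forall>r\<in>{1<..<\<delta> + sqrt (1 + \<delta>\<^sup>2)}.
         (\<forall>v :: real \<Rightarrow> 'a. analytic_at_distance \<delta> v \<longrightarrow> admissible_bernstein r v) \<and>
         (\<forall>u\<in>\<U>. \<forall>n\<in>{1..L}. admissible_bernstein r (block_restriction T L n u)))"
    unfolding Let_def \<delta>_def[symmetric]
  proof (intro conjI ballI allI impI)
    fix r assume "r \<in> {1<..<\<delta> + sqrt (1 + \<delta>\<^sup>2)}"
    then show adm: "admissible_bernstein r v" if "analytic_at_distance \<delta> v"
      for v :: "real \<Rightarrow> 'a"
      using admissible_bernstein_if_analytic_at_distance[OF that] by simp
    show "admissible_bernstein r (block_restriction T L n u)" if "u \<in> \<U>" "n \<in> {1..L}" for u n
      by (rule adm[OF restr[OF that]])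
  qed (use range_nonempty restr in simp_all)
qed

end
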